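(* Let $\Gamma$ be a finite additive Abelian group of order $n$, let $B\subseteq\Gamma\setminus\{0\}$ satisfy $B=-B$, and let $A$ be the adjacency matrix of $H=\mathrm{Cayley}(\Gamma,B)$. Let $p_A(t)$ be the (monic) minimum polynomial of $A$, of degree $\ell$, and set $$q(t)=\frac{p_A(t)}{t-|B|}=q_0+q_1t+\cdots+q_{\ell-1}t^{\ell-1}.$$ Suppose $H$ has $a$ (isomorphic) connected components, i.e. $A$ is permutation-equivalent to a matrix of the form $I\otimes A_1$ with $I$ the $a\times a$ identity matrix and $A_1$ an $(n/a)\times(n/a)$ matrix, the adjacency matrix of a connected component of $H$. Then a contractor for the graph parameter counting the number of $B$-flows of a graph is given by $$Z=\frac{n}{a\,q(|B|)}\sum_{0\le k\le\ell-1}q_kP_1^{k},$$ where $P_1^{k}$ is the 2-labelled graph consisting of two vertices, one labelled $1$ and the other labelled $2$, joined by $k$ parallel edges.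
   Context: **Cayley graph.** $\mathrm{Cayley}(\Gamma,B)$ is the graph on vertex set $\Gamma$ with $i,j$ adjacent if and only if $j-i\in B$. Its connected components correspond to the cosets of the subgroup generated by $B$. **Flows.** Let $G=(V,E)$ be a finite graph (parallel edges and loops allowed) with an arbitrary fixed orientation of its edges. A $\Gamma$-flow is a function $g:E\to\Gamma$ such that for every vertex $v$ the sum of $g(e)$ over non-loop edges $e$ with head $v$ equals the sum of $g(e)$ over non-loop edges $e$ with tail $v$. A $B$-flow is a $\Gamma$-flow all of whose values lie in $B$. As $B=-B$, the number of $B$-flows does not depend on the orientation. **2-labelled graphs.** A 2-labelled graph is a finite graph $X$, without loops but possibly with parallel edges, together with a map $\lambda:\{1,2\}\to V(X)$ (the vertex $\lambda(i)$ is said to carry label $i$; a vertex may carry both labels). A 2-labelled quantum graph is a finite formal linear combination of 2-labelled graphs with real coefficients. The product $XY$ of 2-labelled graphs is obtained by taking the disjoint union of $X$ and $Y$ and identifying vertices carrying the same label (keeping all edges, with multiplicity); it is extended bilinearly to quantum graphs. $K_1$ denotes a single vertex carrying both labels, so $XK_1$ is $X$ with its vertices labelled 1 and 2 identified. **Contractor.** A graph parameter $h$ (an isomorphism-invariant function on graphs) is evaluated on a 2-labelled graph by ignoring labels and is extended linearly to 2-labelled quantum graphs. A 2-labelled quantum graph $Z$ is a contractor for $h$ if $h(XZ)=h(XK_1)$ for every 2-labelled graph $X$ whose vertices labelled 1 and 2 are distinct and non-adjacent (equivalently, for all linear combinations of such $X$). *)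

theory Defs
  imports
    "HOL-Analysis.Analysis"
    "HOL-Computational_Algebra.Polynomial"
    "HOL-Library.Poly_Mapping"
    "HOL-Library.Nat_Bijection"
begin

section \<open>Finite multigraphs\<close>

text \<open>The set of ends of an edge has one element if the edge is a loop and two elements
  otherwise. Parallel edges are distinct edges with the same set of ends.\<close>

record ('v, 'e) mgraph =
  verts :: "'v set"
  edges :: "'e set"
  ends :: "'e \<Rightarrow> 'v set"

definition multigraph :: "('v, 'e, 'x) mgraph_scheme \<Rightarrow> bool" where
  "multigraph G \<longleftrightarrow> finite (verts G) \<and> finite (edges G) \<and>
     (\<forall>e\<in>edges G. ends G e \<subseteq> verts G \<and> card (ends G e) \<in> {1, 2})"

definition loopless :: "('v, 'e, 'x) mgraph_scheme \<Rightarrow> bool" where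
  "loopless G \<longleftrightarrow> (\<forall>e\<in>edges G. card (ends G e) \<noteq> 1)"

definition adjacent :: "('v, 'e, 'x) mgraph_scheme \<Rightarrow> 'v \<Rightarrow> 'v \<Rightarrow> bool" where
  "adjacent G u v \<longleftrightarrow> (\<exists>e\<in>edges G. ends G e = {u, v})"

definition connected_components :: "('v, 'e, 'x) mgraph_scheme \<Rightarrow> 'v set set" where
  "connected_components G = verts G // {(u, v). adjacent G u v}\<^sup>*"

definition graph_iso :: "('v, 'e, 'x) mgraph_scheme \<Rightarrow> ('w, 'f, 'y) mgraph_scheme \<Rightarrow> bool" where
  "graph_iso G G' \<longleftrightarrow> (\<exists>\<phi> \<psi>. bij_betw \<phi> (verts G) (verts G') \<and> bij_betw \<psi> (edges G) (edges G') \<and>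
     (\<forall>e\<in>edges G. ends G' (\<psi> e) = \<phi> ` ends G e))"

text \<open>Every finite multigraph is isomorphic to one whose vertices and edges are natural numbers;
  graph parameters, labelled graphs and their products are considered on this type, which is
  closed under gluing.\<close>

type_synonym graph = "(nat, nat) mgraph"

definition graph_parameter :: "(graph \<Rightarrow> real) \<Rightarrow> bool" where
  "graph_parameter h \<longleftrightarrow>
     (\<forall>G G'. multigraph G \<and> multigraph G' \<and> graph_iso G G' \<longrightarrow> h G = h G')"

section \<open>Cayley graphs and minimum polynomials\<close>

definition Cayley :: "'g::ab_group_add set \<Rightarrow> ('g, 'g set) mgraph" where
  "Cayley B = \<lparr>verts = UNIV, edges = {{i, j} |i j. j - i \<in> B}, ends = id\<rparr>"

text \<open>Only meant for graphs without parallel edges whose vertices are all elements of the type.\<close>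

definition adjacency_matrix :: "('v::finite, 'e, 'x) mgraph_scheme \<Rightarrow> real ^ 'v ^ 'v" where
  "adjacency_matrix G = (\<chi> i j. of_bool (adjacent G i j))"

text \<open>The class instance of \<open>(^)\<close> on \<open>real ^ 'n ^ 'n\<close> is the entrywise power, so powers with
  respect to the matrix product \<open>**\<close> are defined separately.\<close>

definition matrix_power :: "real ^ 'n ^ 'n \<Rightarrow> nat \<Rightarrow> real ^ 'n ^ 'n" where
  "matrix_power A k = (((**) A) ^^ k) (mat 1)"

definition matrix_poly :: "real poly \<Rightarrow> real ^ 'n ^ 'n \<Rightarrow> real ^ 'n ^ 'n" where
  "matrix_poly p A = (\<Sum>k\<le>Polynomial.degree p. coeff p k *\<^sub>R matrix_power A k)"

definition is_min_poly :: "real ^ 'n ^ 'n \<Rightarrow> real poly \<Rightarrow> bool" where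
  "is_min_poly A p \<longleftrightarrow> lead_coeff p = 1 \<and> matrix_poly p A = 0 \<and>
     (\<forall>r. lead_coeff r = 1 \<and> matrix_poly r A = 0 \<longrightarrow> Polynomial.degree p \<le> Polynomial.degree r)"

definition min_poly :: "real ^ 'n ^ 'n \<Rightarrow> real poly" where
  "min_poly A = (THE p. is_min_poly A p)"

section \<open>Flows\<close>

definition orientation ::
  "('v, 'e, 'x) mgraph_scheme \<Rightarrow> ('e \<Rightarrow> 'v) \<times> ('e \<Rightarrow> 'v) \<Rightarrow> bool" where
  "orientation G = (\<lambda>(tail, head). \<forall>e\<in>edges G. ends G e = {tail e, head e})"

definition B_flows ::
  "'g::ab_group_add set \<Rightarrow> ('v, 'e, 'x) mgraph_scheme \<Rightarrow> ('e \<Rightarrow> 'v) \<times> ('e \<Rightarrow> 'v) \<Rightarrow> ('e \<Rightarrow> 'g) set" where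
  "B_flows B G = (\<lambda>(tail, head). {g \<in> edges G \<rightarrow>\<^sub>E B. \<forall>v\<in>verts G.
     (\<Sum>e | e \<in> edges G \<and> tail e \<noteq> head e \<and> head e = v. g e) =
     (\<Sum>e | e \<in> edges G \<and> tail e \<noteq> head e \<and> tail e = v. g e)})"

text \<open>The orientation is arbitrary; see \<open>num_B_flows_eq\<close> below for the independence of the
  choice when \<open>B = -B\<close>.\<close>

definition num_B_flows :: "'g::ab_group_add set \<Rightarrow> ('v, 'e, 'x) mgraph_scheme \<Rightarrow> nat" where
  "num_B_flows B G = card (B_flows B G (SOME ori. orientation G ori))"

section \<open>2-labelled graphs, quantum graphs and contractors\<close>

record graph2 = "(nat, nat) mgraph" +
  lab1 :: nat
  lab2 :: nat

definition labelled_graph :: "graph2 \<Rightarrow> bool" where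
  "labelled_graph X \<longleftrightarrow> multigraph X \<and> loopless X \<and> lab1 X \<in> verts X \<and> lab2 X \<in> verts X"

abbreviation unlabel :: "graph2 \<Rightarrow> graph" where
  "unlabel \<equiv> mgraph.truncate"

text \<open>The least equivalence relation on the disjoint union identifying equal labels. If a vertex
  of one factor carries both labels, then the two labelled vertices of the other factor are
  identified as well. Each class is represented by its least code.\<close>

definition glue :: "graph2 \<Rightarrow> graph2 \<Rightarrow> (nat + nat) rel" where
  "glue X Y = (let R = {(Inl (lab1 X), Inr (lab1 Y)), (Inl (lab2 X), Inr (lab2 Y))} in (R \<union> R\<inverse>)\<^sup>*)"

definition glued_vertex :: "graph2 \<Rightarrow> graph2 \<Rightarrow> nat + nat \<Rightarrow> nat" where
  "glued_vertex X Y u = (LEAST m. (u, sum_decode m) \<in> glue X Y)"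

definition product :: "graph2 \<Rightarrow> graph2 \<Rightarrow> graph2" where
  "product X Y = \<lparr>
     verts = glued_vertex X Y ` (verts X <+> verts Y),
     edges = sum_encode ` (edges X <+> edges Y),
     ends = (\<lambda>m. glued_vertex X Y `
       (case sum_decode m of Inl e \<Rightarrow> Inl ` ends X e | Inr e \<Rightarrow> Inr ` ends Y e)),
     lab1 = glued_vertex X Y (Inl (lab1 X)),
     lab2 = glued_vertex X Y (Inl (lab2 X))\<rparr>"

definition K1 :: graph2 where
  "K1 = \<lparr>verts = {0}, edges = {}, ends = (\<lambda>_. {}), lab1 = 0, lab2 = 0\<rparr>"

definition P1_power :: "nat \<Rightarrow> graph2" where
  "P1_power k = \<lparr>verts = {1, 2}, edges = {..<k}, ends = (\<lambda>_. {1, 2}), lab1 = 1, lab2 = 2\<rparr>"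

type_synonym quantum = "graph2 \<Rightarrow>\<^sub>0 real"

definition quantum_graph :: "quantum \<Rightarrow> bool" where
  "quantum_graph Z \<longleftrightarrow> (\<forall>Y\<in>Poly_Mapping.keys Z. labelled_graph Y)"

definition quantum_scale :: "real \<Rightarrow> quantum \<Rightarrow> quantum" where
  "quantum_scale c Z = Poly_Mapping.map ((*) c) Z"

definition quantum_product :: "quantum \<Rightarrow> quantum \<Rightarrow> quantum" where
  "quantum_product X Y = (\<Sum>x\<in>Poly_Mapping.keys X. \<Sum>y\<in>Poly_Mapping.keys Y.
     Poly_Mapping.single (product x y) (Poly_Mapping.lookup X x * Poly_Mapping.lookup Y y))"

definition quantum_eval :: "(graph \<Rightarrow> real) \<Rightarrow> quantum \<Rightarrow> real" where
  "quantum_eval h Z = (\<Sum>Y\<in>Poly_Mapping.keys Z. Poly_Mapping.lookup Z Y * h (unlabel Y))"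

definition contractor :: "(graph \<Rightarrow> real) \<Rightarrow> quantum \<Rightarrow> bool" where
  "contractor h Z \<longleftrightarrow> graph_parameter h \<and> quantum_graph Z \<and>
     (\<forall>X. labelled_graph X \<and> lab1 X \<noteq> lab2 X \<and> \<not> adjacent X (lab1 X) (lab2 X) \<longrightarrow>
        quantum_eval h (quantum_product (Poly_Mapping.single X 1) Z) = h (unlabel (product X K1)))"

section \<open>Well-definedness\<close>

lemma matrix_poly_altdef:
  assumes "Polynomial.degree p \<le> N"
  shows "matrix_poly p A = (\<Sum>k\<le>N. coeff p k *\<^sub>R matrix_power A k)"
  unfolding matrix_poly_def
  by (rule sum.mono_neutral_left) (use assms in \<open>auto simp: coeff_eq_0\<close>)

lemma matrix_poly_diff: "matrix_poly (p - r) A = matrix_poly p A - matrix_poly r A"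
proof -
  define N where "N = max (Polynomial.degree p) (Polynomial.degree r)"
  have "Polynomial.degree p \<le> N" "Polynomial.degree r \<le> N" "Polynomial.degree (p - r) \<le> N"
    by (auto simp: N_def degree_diff_le_max)
  then show ?thesis
    by (simp add: matrix_poly_altdef scaleR_diff_left sum_subtractf)
qed

lemma matrix_poly_smult: "matrix_poly (smult c p) A = c *\<^sub>R matrix_poly p A"
  using matrix_poly_altdef[of "smult c p" "Polynomial.degree p" A]
  by (simp add: degree_smult_le matrix_poly_def scaleR_sum_right)

lemma matrix_poly_annihilator_exists: "\<exists>r. r \<noteq> 0 \<and> matrix_poly r A = 0"
proof -
  define N where "N = DIM(real ^ 'a ^ 'a)"
  have "\<exists>c. (\<exists>k\<le>N. c k \<noteq> 0) \<and> (\<Sum>k\<le>N. c k *\<^sub>R matrix_power A k) = 0"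
  proof (cases "inj_on (matrix_power A) {..N}")
    case True
    then have "card (matrix_power A ` {..N}) = Suc N"
      by (simp add: card_image)
    then have "dependent (matrix_power A ` {..N})"
      using independent_bound[of "matrix_power A ` {..N}"] by (auto simp: N_def)
    then obtain u where u: "\<exists>v\<in>matrix_power A ` {..N}. u v \<noteq> 0"
      "(\<Sum>v\<in>matrix_power A ` {..N}. u v *\<^sub>R v) = 0"
      by (subst (asm) real_vector.dependent_finite) auto
    then show ?thesis
      using True by (intro exI[of _ "\<lambda>k. u (matrix_power A k)"]) (auto simp: sum.reindex)
  next
    case False
    then obtain i j where ij: "i \<le> N" "j \<le> N" "i \<noteq> j" "matrix_power A i = matrix_power A j"
      by (auto simp: inj_on_def)
    define c :: "nat \<Rightarrow> real" where "c k = (if k = i then 1 else 0) - (if k = j then 1 else 0)" for k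
    have "(\<Sum>k\<le>N. c k *\<^sub>R matrix_power A k) =
      (\<Sum>k\<le>N. if k = i then matrix_power A k else 0) - (\<Sum>k\<le>N. if k = j then matrix_power A k else 0)"
      unfolding sum_subtractf[symmetric] by (rule sum.cong) (auto simp: c_def)
    also have "\<dots> = 0" using ij by simp
    finally show ?thesis
      using ij by (intro exI[of _ c]) (auto simp: c_def intro!: exI[of _ i])
  qed
  then obtain c k where c: "k \<le> N" "c k \<noteq> 0" "(\<Sum>k\<le>N. c k *\<^sub>R matrix_power A k) = 0"
    by blast
  define r where "r = (\<Sum>k\<le>N. monom (c k) k)"
  have coeff: "coeff r j = (if j \<le> N then c j else 0)" for j
    by (simp add: r_def coeff_sum sum.delta')
  have "Polynomial.degree r \<le> N"
    by (rule degree_le) (simp add: coeff)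
  then have "matrix_poly r A = 0"
    using c by (simp add: matrix_poly_altdef coeff)
  moreover have "r \<noteq> 0"
    using c coeff by (metis coeff_0)
  ultimately show ?thesis by blast
qed

lemma is_min_poly_unique_exists: "\<exists>!p. is_min_poly A p"
proof -
  have monic: "\<exists>r'. lead_coeff r' = 1 \<and> matrix_poly r' A = 0 \<and> Polynomial.degree r' = Polynomial.degree r"
    if "r \<noteq> 0" "matrix_poly r A = 0" for r
    using that by (intro exI[of _ "smult (inverse (lead_coeff r)) r"]) (simp add: matrix_poly_smult)
  then have "\<exists>r. lead_coeff r = 1 \<and> matrix_poly r A = 0"
    using matrix_poly_annihilator_exists by blast
  then obtain p where p: "is_min_poly A p"
    using ex_has_least_nat[of "\<lambda>r. lead_coeff r = 1 \<and> matrix_poly r A = 0" _ Polynomial.degree]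
    unfolding is_min_poly_def by blast
  have "p' = p" if p': "is_min_poly A p'" for p'
  proof (rule ccontr)
    assume "p' \<noteq> p"
    then have ne: "p' - p \<noteq> 0" by simp
    have deg: "Polynomial.degree p' = Polynomial.degree p"
      using p p' unfolding is_min_poly_def by (meson order_antisym)
    have "coeff (p' - p) (Polynomial.degree p) = 0"
      using p p' deg by (simp add: is_min_poly_def)
    then have "Polynomial.degree (p' - p) \<noteq> Polynomial.degree p"
      using ne by (metis leading_coeff_0_iff)
    then have "Polynomial.degree (p' - p) < Polynomial.degree p"
      using degree_diff_le_max[of p' p] deg by simp
    moreover have "matrix_poly (p' - p) A = 0"
      using p p' by (simp add: matrix_poly_diff is_min_poly_def)
    ultimately show False
      using monic[OF ne] p unfolding is_min_poly_def by (metis not_less)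
  qed
  with p show ?thesis by blast
qed

lemma is_min_poly_min_poly: "is_min_poly A (min_poly A)"
  unfolding min_poly_def using is_min_poly_unique_exists by (rule theI')

lemma adjacent_Cayley:
  assumes "uminus ` B = B"
  shows "adjacent (Cayley B) i j \<longleftrightarrow> j - i \<in> B"
proof -
  have "i - j \<in> B \<longleftrightarrow> j - i \<in> B" for i j
    using assms by (metis image_eqI minus_diff_eq)
  then show ?thesis
    by (auto simp: adjacent_def Cayley_def doubleton_eq_iff)
qed

lemma orientation_exists:
  assumes "multigraph G"
  shows "\<exists>ori. orientation G ori"
proof -
  have "\<exists>u v. ends G e = {u, v}" if "e \<in> edges G" for e
  proof -
    have "card (ends G e) = 1 \<or> card (ends G e) = 2"
      using assms that by (auto simp: multigraph_def)
    then show ?thesis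
      by (metis card_1_singletonE card_2_iff insert_absorb2)
  qed
  then obtain t h where "\<And>e. e \<in> edges G \<Longrightarrow> ends G e = {t e, h e}"
    by metis
  then show ?thesis
    by (auto simp: orientation_def intro!: exI[of _ "(t, h)"])
qed

lemma card_B_flows_iso:
  fixes B :: "'g::ab_group_add set"
  assumes B: "uminus ` B = B" and G: "multigraph G" and G': "multigraph G'"
    and \<phi>: "bij_betw \<phi> (verts G) (verts G')" and \<psi>: "bij_betw \<psi> (edges G) (edges G')"
    and ends: "\<And>e. e \<in> edges G \<Longrightarrow> ends G' (\<psi> e) = \<phi> ` ends G e"
    and o: "orientation G (t, h)" and o': "orientation G' (t', h')"
  shows "card (B_flows B G (t, h)) = card (B_flows B G' (t', h'))"
proof -
  define s where "s e x = (if t' (\<psi> e) = \<phi> (t e) then x else - x)" for e and x :: 'g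
  have ss: "s e (s e x) = x" for e x by (simp add: s_def)
  have sB: "s e x \<in> B \<longleftrightarrow> x \<in> B" for e x
    using B by (auto simp: s_def) (metis image_eqI minus_minus)
  have fin: "finite (edges G)" using G by (simp add: multigraph_def)
  have endsG: "ends G e = {t e, h e}" if "e \<in> edges G" for e
    using o that by (auto simp: orientation_def)
  have inV: "t e \<in> verts G" "h e \<in> verts G" if "e \<in> edges G" for e
    using G that endsG[OF that] by (auto simp: multigraph_def)
  have inj: "\<phi> u = \<phi> v \<longleftrightarrow> u = v" if "u \<in> verts G" "v \<in> verts G" for u v
    using \<phi> that by (auto simp: bij_betw_def inj_on_def)
  have \<psi>E: "\<psi> e \<in> edges G'" if "e \<in> edges G" for e
    using \<psi> that by (auto simp: bij_betw_def)
  have endsG': "{t' (\<psi> e), h' (\<psi> e)} = {\<phi> (t e), \<phi> (h e)}" if "e \<in> edges G" for e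
    using o' ends[OF that] endsG[OF that] \<psi>E[OF that] by (auto simp: orientation_def)
  have cs: "t' (\<psi> e) = \<phi> (t e) \<and> h' (\<psi> e) = \<phi> (h e) \<or> t' (\<psi> e) = \<phi> (h e) \<and> h' (\<psi> e) = \<phi> (t e)"
    if "e \<in> edges G" for e
    using endsG'[OF that] by (auto simp: doubleton_eq_iff)
  define ex where "ex g v = (\<Sum>e\<in>edges G. if t e \<noteq> h e then
      (if h e = v then g e else 0) - (if t e = v then g e else 0) else 0)"
    for g :: "_ \<Rightarrow> 'g" and v
  define ex' where "ex' g v = (\<Sum>e\<in>edges G'. if t' e \<noteq> h' e then
      (if h' e = v then g e else 0) - (if t' e = v then g e else 0) else 0)"
    for g :: "_ \<Rightarrow> 'g" and v
  have fin': "finite (edges G')" using G' by (simp add: multigraph_def)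
  have split: "(\<Sum>e\<in>E. if T e \<noteq> H e then (if H e = v then g e else 0) - (if T e = v then g e else 0) else 0)
      = (\<Sum>e | e \<in> E \<and> T e \<noteq> H e \<and> H e = v. g e) - (\<Sum>e | e \<in> E \<and> T e \<noteq> H e \<and> T e = v. g e)"
    if "finite E" for E :: "'z set" and T H :: "'z \<Rightarrow> 'y" and v and g :: "'z \<Rightarrow> 'g"
  proof -
    have "(\<Sum>e | e \<in> E \<and> T e \<noteq> H e \<and> H e = v. g e) = (\<Sum>e\<in>E. if T e \<noteq> H e \<and> H e = v then g e else 0)"
      "(\<Sum>e | e \<in> E \<and> T e \<noteq> H e \<and> T e = v. g e) = (\<Sum>e\<in>E. if T e \<noteq> H e \<and> T e = v then g e else 0)"
      using that by (auto simp: sum.inter_filter)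
    then show ?thesis
      by (auto simp flip: sum_subtractf intro!: sum.cong)
  qed
  have flows: "B_flows B G (t, h) = {g \<in> edges G \<rightarrow>\<^sub>E B. \<forall>v\<in>verts G. ex g v = 0}"
    unfolding B_flows_def ex_def split[OF fin] by auto
  have flows': "B_flows B G' (t', h') = {g \<in> edges G' \<rightarrow>\<^sub>E B. \<forall>v\<in>verts G'. ex' g v = 0}"
    unfolding B_flows_def ex'_def split[OF fin'] by auto
  define F where "F g = (\<lambda>e\<in>edges G. s e (g (\<psi> e)))" for g
  define I where "I = inv_into (edges G) \<psi>"
  have I1: "I (\<psi> e) = e" if "e \<in> edges G" for e
    using \<psi> that by (simp add: I_def bij_betw_def inv_into_f_f)
  have I2: "\<psi> (I e) = e" "I e \<in> edges G" if "e \<in> edges G'" for e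
    using \<psi> that by (auto simp: I_def bij_betw_def f_inv_into_f inv_into_into)
  define F' where "F' g = (\<lambda>e\<in>edges G'. s (I e) (g (I e)))" for g
  have key: "ex' g (\<phi> v) = ex (F g) v" if v: "v \<in> verts G" for g v
  proof -
    have "ex' g (\<phi> v) = (\<Sum>e\<in>edges G. if t' (\<psi> e) \<noteq> h' (\<psi> e) then
      (if h' (\<psi> e) = \<phi> v then g (\<psi> e) else 0) - (if t' (\<psi> e) = \<phi> v then g (\<psi> e) else 0) else 0)"
      unfolding ex'_def by (rule sum.reindex_bij_betw[OF \<psi>, symmetric])
    also have "\<dots> = ex (F g) v"
      unfolding ex_def
    proof (rule sum.cong[OF refl])
      fix e assume e: "e \<in> edges G"
      show "(if t' (\<psi> e) \<noteq> h' (\<psi> e) then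
          (if h' (\<psi> e) = \<phi> v then g (\<psi> e) else 0) - (if t' (\<psi> e) = \<phi> v then g (\<psi> e) else 0) else 0)
        = (if t e \<noteq> h e then (if h e = v then F g e else 0) - (if t e = v then F g e else 0) else 0)"
        using cs[OF e] inV[OF e] v e by (auto simp: F_def s_def inj)
    qed
    finally show ?thesis .
  qed
  have FF': "F (F' g) = g" if "g \<in> edges G \<rightarrow>\<^sub>E B" for g
    using that by (auto simp: F_def F'_def fun_eq_iff \<psi>E I1 ss PiE_def extensional_def)
  have F'F: "F' (F g) = g" if "g \<in> edges G' \<rightarrow>\<^sub>E B" for g
    using that by (auto simp: F_def F'_def fun_eq_iff I2 ss PiE_def extensional_def)
  have Fin: "F g \<in> edges G \<rightarrow>\<^sub>E B" if "g \<in> edges G' \<rightarrow>\<^sub>E B" for g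
    using that by (auto simp: F_def sB \<psi>E PiE_def)
  have F'in: "F' g \<in> edges G' \<rightarrow>\<^sub>E B" if "g \<in> edges G \<rightarrow>\<^sub>E B" for g
    using that by (auto simp: F'_def sB I2 PiE_def)
  have vv: "(\<forall>v\<in>verts G'. P v) \<longleftrightarrow> (\<forall>v\<in>verts G. P (\<phi> v))" for P
    using \<phi> by (metis (no_types, lifting) bij_betw_imp_surj_on ball_simps(9))
  have "bij_betw F (B_flows B G' (t', h')) (B_flows B G (t, h))"
    unfolding flows flows'
    by (rule bij_betw_byWitness[where f' = F']) (simp_all add: FF' F'F vv key Fin F'in image_subset_iff del: PiE_iff)
  then show ?thesis
    by (metis bij_betw_same_card)
qed

lemma num_B_flows_eq:
  assumes "uminus ` B = B" "multigraph G" "orientation G ori"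
  shows "num_B_flows B G = card (B_flows B G ori)"
proof -
  have "orientation G (SOME ori. orientation G ori)"
    using assms(3) by (rule someI)
  then show ?thesis
    unfolding num_B_flows_def using assms
      card_B_flows_iso[of B G G id id]
    by (metis bij_betw_id id_apply image_id surj_pair)
qed

lemma graph_parameter_num_B_flows:
  assumes "uminus ` B = B"
  shows "graph_parameter (\<lambda>G. real (num_B_flows B G))"
  unfolding graph_parameter_def
proof (intro allI impI, elim conjE)
  fix G G' :: graph
  assume *: "multigraph G" "multigraph G'" "graph_iso G G'"
  obtain o1 o2 where o: "orientation G o1" "orientation G' o2"
    using orientation_exists * by metis
  with * show "real (num_B_flows B G) = real (num_B_flows B G')"
    using card_B_flows_iso[OF assms *(1,2)] num_B_flows_eq[OF assms]
    unfolding graph_iso_def by (metis surj_pair)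
qed

end

theory Submission
  imports Defs
begin

text \<open>
  Fix an orientation of \<open>X\<close> and let \<open>S\<close> be the set of assignments \<open>E(X) \<rightarrow> B\<close> that conserve flow
  at every vertex except possibly those labelled 1 and 2. The net flow \<open>x\<close> into vertex 1
  is then the negative of the net flow into vertex 2. Identifying the two vertices removes the
  remaining constraint, so \<open>X K\<^sub>1\<close> has \<open>|S|\<close> many \<open>B\<close>-flows. Joining them instead by \<open>k\<close> new edges
  requires the values on these edges to sum to \<open>x\<close>; the number of ways to do this, the number of
  ordered sums of \<open>k\<close> elements of \<open>B\<close> with value \<open>x\<close>, is the entry of \<open>A\<^sup>k\<close> in row \<open>0\<close> and column
  \<open>x\<close>. By linearity, gluing the combination \<open>\<Sum>q\<^sub>k P\<^sub>1\<^sup>k\<close> to \<open>X\<close> gives the sum over \<open>S\<close> of the entries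
  \<open>q(A)\<^sub>0\<^sub>x\<close>. These are evaluated in \<open>walk_poly_min_poly_quotient\<close>, while the two gluings are
  \<open>num_B_flows_product_K1\<close> and \<open>num_B_flows_product_P1_power\<close>.

  The entry \<open>q(A)\<^sub>0\<^sub>x\<close> is the same for all \<open>x\<close> in the component of \<open>0\<close>, which is the subgroup
  generated by \<open>B\<close> and contains every net flow that occurs. Indeed \<open>(A - |B|) q(A) = p(A) = 0\<close>
  says that the sum of \<open>q(A)\<^sub>0\<^sub>y\<close> over the neighbours \<open>y\<close> of \<open>x\<close> is \<open>|B| q(A)\<^sub>0\<^sub>x\<close> for every \<open>x\<close>,
  and such a harmonic function is constant on components. It vanishes off the component of \<open>0\<close>, which has \<open>n / a\<close>
  elements, and the entries of the row add up to \<open>q(|B|)\<close>, so its value on this component is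
  \<open>a q(|B|) / n\<close>. Finally \<open>q(|B|) \<noteq> 0\<close>, because otherwise \<open>q(A) = 0\<close>, contrary to the minimality
  of \<open>p\<close>.
\<close>

section \<open>Powers of the adjacency matrix of a Cayley graph\<close>

definition num_sums :: "'g::ab_group_add set \<Rightarrow> nat \<Rightarrow> 'g \<Rightarrow> nat" where
  "num_sums B k x = card {f \<in> {..<k} \<rightarrow>\<^sub>E B. (\<Sum>i<k. f i) = x}"

lemma num_sums_0: "num_sums B 0 x = of_bool (x = 0)"
  by (auto simp: num_sums_def)

text \<open>Splitting off the last summand \<open>b\<close> gives the recurrence of the powers of \<open>A\<close>.\<close>

lemma num_sums_Suc:
  fixes B :: "'g::{ab_group_add, finite} set"
  shows "num_sums B (Suc k) x = (\<Sum>b\<in>B. num_sums B k (x - b))"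
proof -
  let ?F = "\<lambda>b. {f \<in> {..<k} \<rightarrow>\<^sub>E B. (\<Sum>i<k. f i) = x - b}"
  have fin: "finite (?F b)" for b
    by (rule finite_subset[of _ "{..<k} \<rightarrow>\<^sub>E B"]) (auto intro: finite_PiE)
  have sum: "(\<Sum>i<k. (f(k := b)) i) = (\<Sum>i<k. f i)" for f :: "nat \<Rightarrow> 'g" and b
    by (rule sum.cong) auto
  have "bij_betw (\<lambda>(b, f). f(k := b)) (SIGMA b:B. ?F b) {f \<in> {..<Suc k} \<rightarrow>\<^sub>E B. (\<Sum>i<Suc k. f i) = x}"
  proof (rule bij_betwI')
    fix p r assume "p \<in> (SIGMA b:B. ?F b)" "r \<in> (SIGMA b:B. ?F b)"
    then obtain b f c g where pr: "p = (b, f)" "r = (c, g)"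
      "f \<in> {..<k} \<rightarrow>\<^sub>E B" "g \<in> {..<k} \<rightarrow>\<^sub>E B"
      by auto
    have "f k = undefined" "g k = undefined"
      using pr by (auto simp: PiE_def extensional_def)
    then have "f = (f(k := b))(k := undefined)" "g = (g(k := c))(k := undefined)"
      by auto
    then have "f(k := b) = g(k := c) \<longleftrightarrow> b = c \<and> f = g"
      by (metis fun_upd_same)
    then show "((case p of (b, f) \<Rightarrow> f(k := b)) = (case r of (b, f) \<Rightarrow> f(k := b))) = (p = r)"
      using pr by simp
  next
    fix p assume "p \<in> (SIGMA b:B. ?F b)"
    then obtain b f where p: "p = (b, f)" "b \<in> B" "f \<in> {..<k} \<rightarrow>\<^sub>E B" "(\<Sum>i<k. f i) = x - b"
      by auto
    have "f(k := b) \<in> {..<Suc k} \<rightarrow>\<^sub>E B"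
      unfolding lessThan_Suc using p by (intro PiE_fun_upd) auto
    moreover have "(\<Sum>i<Suc k. (f(k := b)) i) = x"
      unfolding sum.lessThan_Suc sum using p by simp
    ultimately show "(case p of (b, f) \<Rightarrow> f(k := b)) \<in> {f \<in> {..<Suc k} \<rightarrow>\<^sub>E B. (\<Sum>i<Suc k. f i) = x}"
      using p(1) by simp
  next
    fix g assume g: "g \<in> {f \<in> {..<Suc k} \<rightarrow>\<^sub>E B. (\<Sum>i<Suc k. f i) = x}"
    have "(\<Sum>i<k. restrict g {..<k} i) = (\<Sum>i<k. g i)"
      by (rule sum.cong) auto
    then have mem: "(g k, restrict g {..<k}) \<in> (SIGMA b:B. ?F b)"
      using g by (auto simp: PiE_def Pi_def algebra_simps)
    have eq: "g = (restrict g {..<k})(k := g k)"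
      using g by (auto simp: fun_eq_iff PiE_def extensional_def)
    show "\<exists>p\<in>(SIGMA b:B. ?F b). g = (case p of (b, f) \<Rightarrow> f(k := b))"
      by (rule bexI[OF _ mem]) (unfold prod.case, rule eq)
  qed
  from bij_betw_same_card[OF this] have "num_sums B (Suc k) x = card (SIGMA b:B. ?F b)"
    unfolding num_sums_def by (rule sym)
  then show ?thesis
    by (simp add: num_sums_def fin)
qed

text \<open>The two sides count all words of length \<open>k\<close> over \<open>B\<close>, grouped by their sum on the left.
  For matrices this says that the rows of \<open>A\<^sup>k\<close> add up to \<open>|B|\<^sup>k\<close>.\<close>

lemma sum_num_sums:
  fixes B :: "'g::{ab_group_add, finite} set"
  shows "(\<Sum>x\<in>UNIV. num_sums B k x) = card B ^ k"
proof (induction k)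
  case (Suc k)
  have "(\<Sum>x\<in>UNIV. num_sums B (Suc k) x) = (\<Sum>b\<in>B. \<Sum>x\<in>UNIV. num_sums B k (x - b))"
    unfolding num_sums_Suc by (rule sum.swap)
  also have "\<dots> = (\<Sum>b\<in>B. card B ^ k)"
  proof (rule sum.cong[OF refl])
    fix b :: 'g
    have "bij (\<lambda>x. x - b)"
      by (rule bij_betw_byWitness[where f' = "\<lambda>x. x + b"]) auto
    then show "(\<Sum>x\<in>UNIV. num_sums B k (x - b)) = card B ^ k"
      using sum.reindex_bij_betw[of "\<lambda>x. x - b" UNIV UNIV "num_sums B k"] Suc by simp
  qed
  finally show ?case by simp
qed (simp add: num_sums_0 of_bool_def)

text \<open>A walk of length \<open>k\<close> from \<open>i\<close> to \<open>j\<close> in the Cayley graph is determined by its \<open>k\<close> steps,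
  elements of \<open>B\<close> with sum \<open>j - i\<close>.\<close>

lemma matrix_power_adjacency_Cayley:
  fixes B :: "'g::{ab_group_add, finite} set"
  assumes "uminus ` B = B"
  shows "matrix_power (adjacency_matrix (Cayley B)) k $ i $ j = real (num_sums B k (j - i))"
proof (induction k arbitrary: i)
  case 0
  show ?case by (auto simp: matrix_power_def mat_def num_sums_0)
next
  case (Suc k)
  have "matrix_power (adjacency_matrix (Cayley B)) (Suc k) $ i $ j
    = (\<Sum>m\<in>UNIV. of_bool (m - i \<in> B) * real (num_sums B k (j - m)))"
    using Suc assms
    by (simp add: matrix_power_def matrix_matrix_mult_def adjacency_matrix_def adjacent_Cayley)
  also have "\<dots> = (\<Sum>b\<in>UNIV. of_bool (b \<in> B) * real (num_sums B k (j - i - b)))"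
    by (rule sum.reindex_bij_witness[of _ "\<lambda>b. b + i" "\<lambda>m. m - i"]) (auto simp: algebra_simps)
  also have "\<dots> = (\<Sum>b\<in>B. real (num_sums B k (j - i - b)))"
    by (rule sum.mono_neutral_cong_right) auto
  finally show ?case by (simp add: num_sums_Suc)
qed

text \<open>The entry of \<open>p(A)\<close> in row \<open>0\<close> and column \<open>x\<close>. Translations of the group preserve \<open>A\<close>, so
  this row determines the whole matrix, and questions about \<open>p(A)\<close> become questions about a real
  function on the group.\<close>

definition walk_poly :: "'g::ab_group_add set \<Rightarrow> real poly \<Rightarrow> 'g \<Rightarrow> real" where
  "walk_poly B p x = (\<Sum>k\<le>Polynomial.degree p. coeff p k * real (num_sums B k x))"

lemma walk_poly_altdef:
  assumes "Polynomial.degree p \<le> N"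
  shows "walk_poly B p x = (\<Sum>k\<le>N. coeff p k * real (num_sums B k x))"
  unfolding walk_poly_def
  by (rule sum.mono_neutral_left) (use assms in \<open>auto simp: coeff_eq_0\<close>)

lemma matrix_poly_adjacency_Cayley:
  fixes B :: "'g::{ab_group_add, finite} set"
  assumes "uminus ` B = B"
  shows "matrix_poly p (adjacency_matrix (Cayley B)) $ i $ j = walk_poly B p (j - i)"
  by (simp add: matrix_poly_def walk_poly_def matrix_power_adjacency_Cayley[OF assms])

lemma matrix_poly_adjacency_Cayley_eq_0_iff:
  fixes B :: "'g::{ab_group_add, finite} set"
  assumes "uminus ` B = B"
  shows "matrix_poly p (adjacency_matrix (Cayley B)) = 0 \<longleftrightarrow> (\<forall>x. walk_poly B p x = 0)"
  by (auto simp: vec_eq_iff matrix_poly_adjacency_Cayley[OF assms]) (metis diff_zero)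

text \<open>The all-ones vector is an eigenvector of \<open>A\<close> with eigenvalue \<open>|B|\<close>.\<close>

lemma sum_walk_poly:
  fixes B :: "'g::{ab_group_add, finite} set"
  shows "(\<Sum>x\<in>UNIV. walk_poly B p x) = poly p (real (card B))"
proof -
  have "(\<Sum>x\<in>UNIV. walk_poly B p x) = (\<Sum>k\<le>Polynomial.degree p. coeff p k * real (\<Sum>x\<in>UNIV. num_sums B k x))"
    unfolding walk_poly_def by (subst sum.swap) (simp add: sum_distrib_left)
  then show ?thesis
    by (simp only: sum_num_sums) (simp add: poly_altdef)
qed

text \<open>This is \<open>((t - d) q)(A) = A q(A) - d q(A)\<close>, read in row \<open>0\<close>.\<close>

lemma walk_poly_linear_factor:
  fixes B :: "'g::{ab_group_add, finite} set"
  shows "walk_poly B ([:- d, 1:] * q) x = (\<Sum>b\<in>B. walk_poly B q (x - b)) - d * walk_poly B q x"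
proof -
  let ?N = "Polynomial.degree q"
  have "walk_poly B ([:- d, 1:] * q) x
    = (\<Sum>k\<le>Suc ?N. (coeff (pCons 0 q) k - d * coeff q k) * real (num_sums B k x))"
  proof (subst walk_poly_altdef[of _ "Suc ?N"])
    show "Polynomial.degree ([:- d, 1:] * q) \<le> Suc ?N"
      by (rule order.trans[OF degree_mult_le]) simp
  qed simp
  also have "\<dots> = (\<Sum>k\<le>Suc ?N. coeff (pCons 0 q) k * real (num_sums B k x))
      - d * (\<Sum>k\<le>Suc ?N. coeff q k * real (num_sums B k x))"
    by (simp add: left_diff_distrib sum_subtractf sum_distrib_left mult.assoc del: sum.atMost_Suc)
  also have "(\<Sum>k\<le>Suc ?N. coeff q k * real (num_sums B k x)) = walk_poly B q x"
    by (rule walk_poly_altdef[symmetric]) simp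
  also have "(\<Sum>k\<le>Suc ?N. coeff (pCons 0 q) k * real (num_sums B k x))
      = (\<Sum>k\<le>?N. \<Sum>b\<in>B. coeff q k * real (num_sums B k (x - b)))"
    by (subst sum.atMost_Suc_shift) (simp add: num_sums_Suc sum_distrib_left)
  also have "\<dots> = (\<Sum>b\<in>B. walk_poly B q (x - b))"
    unfolding walk_poly_def by (rule sum.swap)
  finally show ?thesis .
qed

section \<open>Harmonic functions and components\<close>

text \<open>Expanding the square, the Dirichlet energy \<open>\<Sum>\<^sub>x \<Sum>\<^sub>b (f (x - b) - f x)\<^sup>2\<close> becomes
  \<open>2 |B| \<Sum>f\<^sup>2 - 2 |B| \<Sum>f\<^sup>2 = 0\<close>: translations preserve \<open>\<Sum>f\<^sup>2\<close>, and the mixed terms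
  are evaluated by the assumption on \<open>f\<close>. So every difference is zero.\<close>

lemma harmonic_invariant:
  fixes B :: "'g::{ab_group_add, finite} set" and f :: "'g \<Rightarrow> real"
  assumes harm: "\<And>x. (\<Sum>b\<in>B. f (x - b)) = real (card B) * f x" and b: "b \<in> B"
  shows "f (x - b) = f x"
proof -
  have shift: "(\<Sum>x\<in>UNIV. (f (x - b))\<^sup>2) = (\<Sum>x\<in>UNIV. (f x)\<^sup>2)" for b
    by (rule sum.reindex_bij_witness[of _ "\<lambda>x. x + b" "\<lambda>x. x - b"]) auto
  have 1: "(\<Sum>x\<in>UNIV. \<Sum>b\<in>B. (f (x - b))\<^sup>2) = real (card B) * (\<Sum>x\<in>UNIV. (f x)\<^sup>2)"
    by (subst sum.swap) (simp add: shift)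
  have "(\<Sum>b\<in>B. f x * f (x - b)) = real (card B) * (f x)\<^sup>2" for x
    by (simp add: harm power2_eq_square flip: sum_distrib_left)
  then have 2: "(\<Sum>x\<in>UNIV. \<Sum>b\<in>B. f x * f (x - b)) = real (card B) * (\<Sum>x\<in>UNIV. (f x)\<^sup>2)"
    by (simp add: sum_distrib_left)
  have "(\<Sum>x\<in>UNIV. \<Sum>b\<in>B. (f (x - b) - f x)\<^sup>2)
    = (\<Sum>x\<in>UNIV. \<Sum>b\<in>B. (f (x - b))\<^sup>2) + real (card B) * (\<Sum>x\<in>UNIV. (f x)\<^sup>2)
      - 2 * (\<Sum>x\<in>UNIV. \<Sum>b\<in>B. f x * f (x - b))"
    by (simp add: power2_diff sum.distrib sum_subtractf sum_distrib_left mult_ac)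
  then have "(\<Sum>x\<in>UNIV. \<Sum>b\<in>B. (f (x - b) - f x)\<^sup>2) = 0"
    using 1 2 by simp
  then have "(\<Sum>b\<in>B. (f (x - b) - f x)\<^sup>2) = 0"
    by (subst (asm) sum_nonneg_eq_0_iff) (auto intro: sum_nonneg)
  then show ?thesis
    using b by (subst (asm) sum_nonneg_eq_0_iff) auto
qed

text \<open>This is the subgroup generated by \<open>B\<close>; its cosets are the components of the Cayley graph.\<close>

definition zero_component :: "'g::ab_group_add set \<Rightarrow> 'g set" where
  "zero_component B = {(u, v). adjacent (Cayley B) u v}\<^sup>* `` {0}"

context
  fixes B :: "'g::ab_group_add set"
  assumes B: "uminus ` B = B"
begin

lemma reachable_translate:
  assumes "(x, y) \<in> {(u, v). adjacent (Cayley B) u v}\<^sup>*"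
  shows "(x + c, y + c) \<in> {(u, v). adjacent (Cayley B) u v}\<^sup>*"
  using assms
proof induction
  case (step y z)
  then show ?case
    by (intro rtrancl_into_rtrancl[OF step.IH]) (simp add: adjacent_Cayley[OF B])
qed simp

lemma sym_reachable: "sym ({(u, v). adjacent (Cayley B) u v}\<^sup>*)"
  by (rule sym_rtrancl) (auto simp: sym_def adjacent_def insert_commute)

lemma zero_component_0: "0 \<in> zero_component B"
  by (simp add: zero_component_def)

lemma subset_zero_component: "B \<subseteq> zero_component B"
  by (auto simp: zero_component_def adjacent_Cayley[OF B])

lemma zero_component_add:
  assumes "x \<in> zero_component B" "y \<in> zero_component B"
  shows "x + y \<in> zero_component B"
  using assms reachable_translate[of 0 y x]
  by (auto simp: zero_component_def add.commute intro: rtrancl_trans)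

lemma zero_component_uminus:
  assumes "x \<in> zero_component B"
  shows "- x \<in> zero_component B"
  using assms reachable_translate[of 0 x "- x"] symD[OF sym_reachable]
  by (auto simp: zero_component_def)

lemma zero_component_sum:
  "(\<And>i. i \<in> I \<Longrightarrow> f i \<in> zero_component B) \<Longrightarrow> (\<Sum>i\<in>I. f i) \<in> zero_component B"
  by (induction I rule: infinite_finite_induct) (auto intro: zero_component_add zero_component_0)

lemma reachable_iff:
  "(x, y) \<in> {(u, v). adjacent (Cayley B) u v}\<^sup>* \<longleftrightarrow> y - x \<in> zero_component B"
  using reachable_translate[of x y "- x"] reachable_translate[of 0 "y - x" x]
  by (auto simp: zero_component_def)

lemma num_sums_outside_zero_component:
  assumes "x \<notin> zero_component B"
  shows "num_sums B k x = 0"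
proof -
  have "{f \<in> {..<k} \<rightarrow>\<^sub>E B. (\<Sum>i<k. f i) = x} = {}"
    using assms zero_component_sum[of "{..<k}"] subset_zero_component by (fastforce simp: PiE_def Pi_def)
  then show ?thesis
    unfolding num_sums_def by (simp only: card.empty)
qed

end

lemma card_components_Cayley:
  fixes B :: "'g::{ab_group_add, finite} set"
  assumes B: "uminus ` B = B"
  shows "card (zero_component B) * card (connected_components (Cayley B)) = CARD('g)"
proof -
  let ?R = "{(u, v). adjacent (Cayley B) u v}\<^sup>*"
  have equiv: "equiv UNIV ?R"
    by (auto simp: equiv_def refl_on_def trans_rtrancl sym_reachable[OF B])
  have card: "card (?R `` {x}) = card (zero_component B)" for x
  proof -
    have "?R `` {x} = (+) x ` zero_component B"
      by (auto simp: reachable_iff[OF B] image_iff intro!: bexI[of _ "_ - x"])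
    then show ?thesis by (simp add: card_image)
  qed
  have "card (zero_component B) * card (UNIV // ?R) = card (\<Union>(UNIV // ?R))"
  proof (rule card_partition)
    show "card c = card (zero_component B)" if "c \<in> UNIV // ?R" for c
      using that card by (auto simp only: elim!: quotientE)
    show "c \<inter> c' = {}" if "c \<in> UNIV // ?R" "c' \<in> UNIV // ?R" "c \<noteq> c'" for c c'
      using quotient_disj[OF equiv that(1,2)] that(3) by blast
  qed simp_all
  also have "\<Union>(UNIV // ?R) = UNIV"
    using equiv by (rule Union_quotient)
  finally show ?thesis
    by (simp add: connected_components_def Cayley_def)
qed

lemma harmonic_constant_on_zero_component:
  fixes B :: "'g::{ab_group_add, finite} set" and f :: "'g \<Rightarrow> real"
  assumes B: "uminus ` B = B"
    and harm: "\<And>x. (\<Sum>b\<in>B. f (x - b)) = real (card B) * f x"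
    and x: "x \<in> zero_component B"
  shows "f x = f 0"
proof -
  have "(0, x) \<in> {(u, v). adjacent (Cayley B) u v}\<^sup>*"
    using x by (simp add: zero_component_def)
  then show ?thesis
  proof induction
    case (step y z)
    then have "z - y \<in> B" by (simp add: adjacent_Cayley[OF B])
    then show ?case
      using harmonic_invariant[OF harm, of "z - y" z] step.IH by simp
  qed simp
qed

section \<open>The quotient of the minimum polynomial\<close>

text \<open>In row \<open>0\<close>, the matrix \<open>q(A)\<close> is harmonic because \<open>(A - |B|) q(A) = 0\<close>, so it is constant on the
  component of \<open>0\<close>, and it is zero elsewhere. The constant follows from the sum of the row. If
  \<open>q(|B|)\<close> were zero, the constant would be zero and \<open>q\<close> would be a monic annihilator of \<open>A\<close> of
  smaller degree than \<open>p\<close>.\<close>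

lemma walk_poly_min_poly_quotient:
  fixes B :: "'g::{ab_group_add, finite} set"
  assumes B: "uminus ` B = B"
  defines "p \<equiv> min_poly (adjacency_matrix (Cayley B))"
  defines "q \<equiv> p div [:- real (card B), 1:]"
  shows "Polynomial.degree q = Polynomial.degree p - 1"
    and "poly q (real (card B)) \<noteq> 0"
    and "x \<in> zero_component B \<Longrightarrow>
      walk_poly B q x = poly q (real (card B)) / real (card (zero_component B))"
proof -
  let ?d = "real (card B)"
  have p: "lead_coeff p = 1" "\<And>x. walk_poly B p x = 0"
    and min: "\<And>r. lead_coeff r = 1 \<Longrightarrow> (\<forall>x. walk_poly B r x = 0) \<Longrightarrow>
      Polynomial.degree p \<le> Polynomial.degree r"
    using is_min_poly_min_poly[of "adjacency_matrix (Cayley B)"]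
    by (auto simp: is_min_poly_def p_def matrix_poly_adjacency_Cayley_eq_0_iff[OF B])
  have "poly p ?d = 0"
    using p by (simp flip: sum_walk_poly)
  then have "[:- ?d, 1:] dvd p"
    by (simp add: poly_eq_0_iff_dvd)
  then have pq: "p = [:- ?d, 1:] * q"
    unfolding q_def by (rule dvd_mult_div_cancel[symmetric])
  have "q \<noteq> 0" using p pq by auto
  then have deg: "Polynomial.degree p = Suc (Polynomial.degree q)"
    unfolding pq by (subst degree_mult_eq) auto
  then show "Polynomial.degree q = Polynomial.degree p - 1" by simp
  have "lead_coeff q = 1"
    using p(1) unfolding pq lead_coeff_mult by simp
  have harm: "(\<Sum>b\<in>B. walk_poly B q (x - b)) = ?d * walk_poly B q x" for x
    using p(2)[of x] unfolding pq walk_poly_linear_factor by simp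
  have const: "walk_poly B q x = walk_poly B q 0" if "x \<in> zero_component B" for x
    using harmonic_constant_on_zero_component[OF B harm that] .
  have zero: "walk_poly B q x = 0" if "x \<notin> zero_component B" for x
    using that by (simp add: walk_poly_def num_sums_outside_zero_component[OF B])
  have "poly q ?d = (\<Sum>x\<in>zero_component B. walk_poly B q x)"
    unfolding sum_walk_poly[symmetric] by (rule sum.mono_neutral_right) (auto simp: zero)
  also have "\<dots> = real (card (zero_component B)) * walk_poly B q 0"
    by (simp add: const)
  finally have qd: "poly q ?d = real (card (zero_component B)) * walk_poly B q 0" .
  have K: "card (zero_component B) \<noteq> 0"
    using zero_component_0[OF B] by auto
  show "poly q ?d \<noteq> 0"
  proof
    assume "poly q ?d = 0"
    then have "\<forall>x. walk_poly B q x = 0"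
      using qd K const zero by (metis mult_eq_0_iff of_nat_eq_0_iff)
    then show False
      using min[OF \<open>lead_coeff q = 1\<close>] deg by simp
  qed
  show "walk_poly B q x = poly q ?d / real (card (zero_component B))" if "x \<in> zero_component B"
    using qd K const[OF that] by simp
qed

section \<open>Flows on glued graphs\<close>

text \<open>A loop contributes its value once with each sign, so loops need not be excluded here, and the
  excess can be transported along maps that identify vertices without a case distinction on which
  edges become loops.\<close>

definition excess :: "'e set \<Rightarrow> ('e \<Rightarrow> 'v) \<Rightarrow> ('e \<Rightarrow> 'v) \<Rightarrow> ('e \<Rightarrow> 'g::ab_group_add) \<Rightarrow> 'v \<Rightarrow> 'g" where
  "excess E t h g v = (\<Sum>e\<in>E. (if h e = v then g e else 0) - (if t e = v then g e else 0))"

lemma B_flows_excess: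
  fixes B :: "'g::ab_group_add set"
  assumes "finite (edges G)"
  shows "B_flows B G (t, h) = {g \<in> edges G \<rightarrow>\<^sub>E B. \<forall>v\<in>verts G. excess (edges G) t h g v = 0}"
proof -
  have "excess (edges G) t h g v =
    (\<Sum>e | e \<in> edges G \<and> t e \<noteq> h e \<and> h e = v. g e) -
    (\<Sum>e | e \<in> edges G \<and> t e \<noteq> h e \<and> t e = v. g e)" for g :: "_ \<Rightarrow> 'g" and v
    using assms unfolding excess_def
    by (auto simp: sum.inter_filter simp flip: sum_subtractf intro!: sum.cong)
  then show ?thesis
    by (simp add: B_flows_def)
qed

lemma sum_excess:
  assumes "finite V" "t ` E \<subseteq> V" "h ` E \<subseteq> V"
  shows "(\<Sum>v\<in>V. excess E t h g v) = 0"
  unfolding excess_def using assms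
  by (subst sum.swap) (auto simp: sum_subtractf image_subset_iff intro!: sum.neutral)

text \<open>Gluing is an equivalence relation, and the code of a vertex is the least code of an element of
  its class.\<close>

lemma glued_vertex_eq_iff: "glued_vertex X Y a = glued_vertex X Y b \<longleftrightarrow> (a, b) \<in> glue X Y"
proof -
  have refl: "(c, c) \<in> glue X Y" for c
    by (simp add: glue_def)
  have sym: "sym (glue X Y)"
    unfolding glue_def Let_def by (rule sym_rtrancl) (rule sym_Un_converse)
  have trans: "trans (glue X Y)"
    by (simp add: glue_def trans_rtrancl)
  have least: "(c, sum_decode (glued_vertex X Y c)) \<in> glue X Y" for c
    unfolding glued_vertex_def by (rule LeastI[of _ "sum_encode c"]) (simp add: refl)
  show ?thesis
  proof
    assume "glued_vertex X Y a = glued_vertex X Y b"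
    then show "(a, b) \<in> glue X Y"
      using least[of a] least[of b] sym trans by (metis symD transD)
  next
    assume "(a, b) \<in> glue X Y"
    then have "(a, c) \<in> glue X Y \<longleftrightarrow> (b, c) \<in> glue X Y" for c
      using sym trans by (metis symD transD)
    then show "glued_vertex X Y a = glued_vertex X Y b"
      by (simp add: glued_vertex_def)
  qed
qed

lemma glue_respects:
  assumes "f (Inl (lab1 X)) = f (Inr (lab1 Y))" "f (Inl (lab2 X)) = f (Inr (lab2 Y))"
    and "(a, b) \<in> glue X Y"
  shows "f a = f b"
  using assms(3) unfolding glue_def Let_def
  by induction (use assms(1,2) in auto)

text \<open>A function \<open>f\<close> that is constant on the glued classes and sends each vertex to (the name in \<open>X\<close>
  of) a member of its class identifies the vertices of the product with the values of \<open>f\<close>. The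
  excess in the product is then the sum of the excesses in the factors, with all end points
  pushed forward along \<open>f\<close>. This reduces the gluings with \<open>K\<^sub>1\<close> and with parallel edges to
  choosing \<open>f\<close>.\<close>

lemma num_B_flows_product:
  fixes B :: "'g::{ab_group_add, finite} set" and f :: "nat + nat \<Rightarrow> nat"
  assumes B: "uminus ` B = B"
    and X: "multigraph X" "orientation X (t, h)" and Y: "multigraph Y" "orientation Y (t', h')"
    and lab: "f (Inl (lab1 X)) = f (Inr (lab1 Y))" "f (Inl (lab2 X)) = f (Inr (lab2 Y))"
    and f: "\<And>a. a \<in> verts X <+> verts Y \<Longrightarrow> (a, Inl (f a)) \<in> glue X Y"
  shows "num_B_flows B (unlabel (product X Y)) =
    card {(g, g') \<in> (edges X \<rightarrow>\<^sub>E B) \<times> (edges Y \<rightarrow>\<^sub>E B). \<forall>v\<in>f ` (verts X <+> verts Y).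
      excess (edges X) (f \<circ> Inl \<circ> t) (f \<circ> Inl \<circ> h) g v +
      excess (edges Y) (f \<circ> Inr \<circ> t') (f \<circ> Inr \<circ> h') g' v = 0}"
proof -
  let ?gv = "glued_vertex X Y"
  let ?V = "verts X <+> verts Y" and ?E = "edges X <+> edges Y"
  let ?ends = "\<lambda>e. case e of Inl e \<Rightarrow> Inl ` ends X e | Inr e \<Rightarrow> Inr ` ends Y e"
  \<comment> \<open>The product with its vertices named by \<open>f\<close> instead of by least codes.\<close>
  define G where "G = \<lparr>verts = f ` ?V, edges = ?E, ends = (\<lambda>e. f ` ?ends e)\<rparr>"
  define T where "T = case_sum (f \<circ> Inl \<circ> t) (f \<circ> Inr \<circ> t')"
  define H where "H = case_sum (f \<circ> Inl \<circ> h) (f \<circ> Inr \<circ> h')"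
  have fin: "finite (edges X)" "finite (edges Y)" "finite (verts X)" "finite (verts Y)"
    using X Y by (auto simp: multigraph_def)
  have "\<forall>e\<in>edges X. ends X e \<subseteq> verts X" "\<forall>e\<in>edges Y. ends Y e \<subseteq> verts Y"
    using X(1) Y(1) by (simp_all add: multigraph_def)
  then have ends_sub: "?ends e \<subseteq> ?V" if "e \<in> ?E" for e
    using that by (cases e) fastforce+
  have oG: "orientation G (T, H)"
    using X Y by (auto simp: orientation_def G_def T_def H_def)
  have card: "card {x, y} \<in> {1, 2}" for x y :: 'z
    by (simp add: card_insert_if)
  have mG: "multigraph G"
    unfolding multigraph_def
  proof (intro conjI ballI)
    fix e assume e: "e \<in> edges G"
    then show "ends G e \<subseteq> verts G"
      using ends_sub[of e] by (auto simp: G_def)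
    show "card (ends G e) \<in> {1, 2}"
      using oG e card by (simp add: orientation_def)
  qed (simp_all add: G_def fin)
  have gv: "?gv (Inl (f a)) = ?gv a" if "a \<in> ?V" for a
    using f[OF that] by (metis glued_vertex_eq_iff)
  have gv_img: "(\<lambda>x. ?gv (Inl x)) ` f ` S = ?gv ` S" if "S \<subseteq> ?V" for S
    unfolding image_image by (rule image_cong[OF refl]) (use that gv in blast)
  have inj: "inj_on (\<lambda>x. ?gv (Inl x)) (f ` ?V)"
  proof (rule inj_onI)
    fix x y assume "x \<in> f ` ?V" "y \<in> f ` ?V" and eq: "?gv (Inl x) = ?gv (Inl y)"
    then obtain a b where ab: "x = f a" "a \<in> ?V" "y = f b" "b \<in> ?V" by blast
    then have "(a, b) \<in> glue X Y"
      using gv eq by (metis glued_vertex_eq_iff)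
    then show "x = y"
      using glue_respects[OF lab] ab by blast
  qed
  let ?P = "unlabel (product X Y)"
  have P: "verts ?P = ?gv ` ?V" "edges ?P = sum_encode ` ?E"
    "ends ?P (sum_encode e) = ?gv ` ?ends e" for e
    by (simp_all add: product_def mgraph.truncate_def)
  have \<phi>: "bij_betw (\<lambda>x. ?gv (Inl x)) (verts G) (verts ?P)"
    using inj gv_img[of ?V] by (simp add: bij_betw_def G_def P)
  have \<psi>: "bij_betw sum_encode (edges G) (edges ?P)"
    by (simp add: bij_betw_def G_def P inj_sum_encode)
  have ends: "ends ?P (sum_encode e) = (\<lambda>x. ?gv (Inl x)) ` ends G e" if "e \<in> edges G" for e
    using gv_img[OF ends_sub] that by (simp add: G_def P)
  \<comment> \<open>The orientation of the product carried over from \<open>G\<close>.\<close>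
  define T' where "T' m = ?gv (Inl (T (sum_decode m)))" for m
  define H' where "H' m = ?gv (Inl (H (sum_decode m)))" for m
  have oP: "orientation ?P (T', H')"
    unfolding orientation_def
  proof (simp only: prod.case, rule ballI)
    fix m assume "m \<in> edges ?P"
    then obtain e where e: "m = sum_encode e" "e \<in> edges G" by (auto simp: P G_def)
    then show "ends ?P m = {T' m, H' m}"
      using ends[OF e(2)] oG by (simp add: orientation_def T'_def H'_def)
  qed
  have mP: "multigraph ?P"
    unfolding multigraph_def
  proof (intro conjI ballI)
    fix m assume m: "m \<in> edges ?P"
    then obtain e where e: "m = sum_encode e" "e \<in> edges G" by (auto simp: P G_def)
    show "ends ?P m \<subseteq> verts ?P"
      using ends_sub[of e] e by (auto simp: P G_def)
    show "card (ends ?P m) \<in> {1, 2}"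
      using oP m card by (simp add: orientation_def)
  qed (simp_all add: P fin)
  have "num_B_flows B ?P = card (B_flows B ?P (T', H'))"
    by (rule num_B_flows_eq[OF B mP oP])
  also have "\<dots> = card (B_flows B G (T, H))"
    by (rule card_B_flows_iso[OF B mG mP \<phi> \<psi> ends oG oP, symmetric])
  also have "B_flows B G (T, H) = {g \<in> ?E \<rightarrow>\<^sub>E B. \<forall>v\<in>f ` ?V. excess ?E T H g v = 0}"
    by (subst B_flows_excess) (simp_all add: G_def fin)
  also have "card \<dots> = card {(g, g') \<in> (edges X \<rightarrow>\<^sub>E B) \<times> (edges Y \<rightarrow>\<^sub>E B). \<forall>v\<in>f ` ?V.
      excess (edges X) (f \<circ> Inl \<circ> t) (f \<circ> Inl \<circ> h) g v +
      excess (edges Y) (f \<circ> Inr \<circ> t') (f \<circ> Inr \<circ> h') g' v = 0}" (is "card ?L = card ?R")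
  proof (rule bij_betw_same_card)
    let ?F = "\<lambda>g. (restrict (g \<circ> Inl) (edges X), restrict (g \<circ> Inr) (edges Y))"
    let ?F' = "\<lambda>(g, g'). restrict (case_sum g g') ?E"
    have split: "excess ?E T H g v =
        excess (edges X) (f \<circ> Inl \<circ> t) (f \<circ> Inl \<circ> h) (restrict (g \<circ> Inl) (edges X)) v +
        excess (edges Y) (f \<circ> Inr \<circ> t') (f \<circ> Inr \<circ> h') (restrict (g \<circ> Inr) (edges Y)) v"
      for g :: "nat + nat \<Rightarrow> 'g" and v
      unfolding excess_def sum.Plus[OF fin(1,2)]
      by (intro arg_cong2[where f = "(+)"] sum.cong) (auto simp: T_def H_def)
    have inv: "?F (?F' r) = r" if "r \<in> (edges X \<rightarrow>\<^sub>E B) \<times> (edges Y \<rightarrow>\<^sub>E B)" for r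
      using that by (auto simp: fun_eq_iff PiE_def extensional_def)
    have inv': "?F' (?F g) = g" if "g \<in> ?E \<rightarrow>\<^sub>E B" for g
      using that by (auto simp: fun_eq_iff PiE_def extensional_def split: sum.splits)
    have F: "?F g \<in> (edges X \<rightarrow>\<^sub>E B) \<times> (edges Y \<rightarrow>\<^sub>E B)" if "g \<in> ?E \<rightarrow>\<^sub>E B" for g
      using that by (auto simp: PiE_def Pi_def)
    have F': "?F' r \<in> ?E \<rightarrow>\<^sub>E B" if "r \<in> (edges X \<rightarrow>\<^sub>E B) \<times> (edges Y \<rightarrow>\<^sub>E B)" for r
      using that by (auto simp: PiE_def Pi_def)
    show "bij_betw ?F ?L ?R"
    proof (rule bij_betw_byWitness[where f' = ?F'])
      show "\<forall>g\<in>?L. ?F' (?F g) = g" using inv' by blast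
      show "\<forall>r\<in>?R. ?F (?F' r) = r" using inv by blast
      show "?F ` ?L \<subseteq> ?R"
        using F split by auto
      show "?F' ` ?R \<subseteq> ?L"
      proof (rule image_subsetI)
        fix r assume r: "r \<in> ?R"
        then have r': "r \<in> (edges X \<rightarrow>\<^sub>E B) \<times> (edges Y \<rightarrow>\<^sub>E B)" by blast
        have "excess ?E T H (?F' r) v = 0" if "v \<in> f ` ?V" for v
          using r inv[OF r'] that unfolding split by auto
        then show "?F' r \<in> ?L"
          using F'[OF r'] by blast
      qed
    qed
  qed
  finally show ?thesis .
qed

text \<open>The set \<open>S\<close> of the introduction: flows in \<open>X\<close> that may have a source and a sink at the
  labelled vertices.\<close>

definition flows_between ::
  "'g::ab_group_add set \<Rightarrow> graph2 \<Rightarrow> (nat \<Rightarrow> nat) \<Rightarrow> (nat \<Rightarrow> nat) \<Rightarrow> (nat \<Rightarrow> 'g) set" where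
  "flows_between B X t h = {g \<in> edges X \<rightarrow>\<^sub>E B.
     \<forall>v\<in>verts X - {lab1 X, lab2 X}. excess (edges X) t h g v = 0}"

context
  fixes B :: "'g::{ab_group_add, finite} set" and X :: graph2 and t h :: "nat \<Rightarrow> nat"
  assumes B: "uminus ` B = B" and X: "labelled_graph X" "lab1 X \<noteq> lab2 X"
    and orient: "orientation X (t, h)"
begin

lemma finite_edges_verts: "finite (edges X)" "finite (verts X)"
  using X by (auto simp: labelled_graph_def multigraph_def)

lemma lab_in_verts: "lab1 X \<in> verts X" "lab2 X \<in> verts X"
  using X by (auto simp: labelled_graph_def)

text \<open>The excesses at all vertices add up to zero, and only those at the labels can be nonzero.\<close>

lemma flows_between_excess_lab2:
  assumes "g \<in> flows_between B X t h"
  shows "excess (edges X) t h g (lab2 X) = - excess (edges X) t h g (lab1 X)"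
proof -
  have "e \<in> edges X \<Longrightarrow> t e \<in> verts X \<and> h e \<in> verts X" for e
    using X orient by (force simp: labelled_graph_def multigraph_def orientation_def)
  then have "0 = (\<Sum>v\<in>verts X. excess (edges X) t h g v)"
    by (intro sum_excess[symmetric] finite_edges_verts) auto
  also have "\<dots> = (\<Sum>v\<in>{lab1 X, lab2 X}. excess (edges X) t h g v)"
    using assms lab_in_verts finite_edges_verts by (intro sum.mono_neutral_right) (auto simp: flows_between_def)
  also have "\<dots> = excess (edges X) t h g (lab1 X) + excess (edges X) t h g (lab2 X)"
    using X by simp
  finally show ?thesis by (simp add: eq_neg_iff_add_eq_0 add.commute)
qed

lemma finite_flows_between: "finite (flows_between B X t h)"
  by (rule finite_subset[of _ "edges X \<rightarrow>\<^sub>E B"]) (auto simp: flows_between_def finite_edges_verts intro: finite_PiE)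

text \<open>The excess at the merged vertex is the sum of the excesses at the two labels, which vanishes
  on its own.\<close>

lemma num_B_flows_product_K1:
  "num_B_flows B (unlabel (product X K1)) = card (flows_between B X t h)"
proof -
  \<comment> \<open>The merged vertex keeps the name of the vertex labelled 1.\<close>
  define c where "c x = (if x = lab2 X then lab1 X else x)" for x
  let ?f = "case_sum c (\<lambda>_::nat. lab1 X)"
  have glue2: "(Inl (lab2 X), Inr 0) \<in> glue X K1" and glue1: "(Inr 0, Inl (lab1 X)) \<in> glue X K1"
    by (auto simp: glue_def K1_def Let_def)
  have glue12: "(Inl (lab2 X), Inl (lab1 X)) \<in> glue X K1"
    using glue2 glue1 unfolding glue_def Let_def by (rule rtrancl_trans)
  have refl: "(a, a) \<in> glue X K1" for a by (simp add: glue_def)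
  have V: "?f ` (verts X <+> verts K1) = verts X - {lab2 X}"
  proof -
    have "c ` verts X = verts X - {lab2 X}"
    proof
      show "verts X - {lab2 X} \<subseteq> c ` verts X"
        by (rule subsetI, rule image_eqI) (auto simp: c_def)
    qed (use X(2) lab_in_verts in \<open>auto simp: c_def\<close>)
    then show ?thesis
      using X(2) lab_in_verts by (auto simp: Plus_def image_Un image_image K1_def)
  qed
  have ex: "excess (edges X) (c \<circ> t) (c \<circ> h) g v =
      excess (edges X) t h g v + (if v = lab1 X then excess (edges X) t h g (lab2 X) else 0)"
    if "v \<noteq> lab2 X" for g :: "nat \<Rightarrow> 'g" and v
    using that X(2) by (auto simp: excess_def c_def simp flip: sum.distrib intro!: sum.cong)
  have "num_B_flows B (unlabel (product X K1)) =
    card {(g, g') \<in> (edges X \<rightarrow>\<^sub>E B) \<times> (edges K1 \<rightarrow>\<^sub>E B). \<forall>v\<in>?f ` (verts X <+> verts K1).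
      excess (edges X) (?f \<circ> Inl \<circ> t) (?f \<circ> Inl \<circ> h) g v +
      excess (edges K1) (?f \<circ> Inr \<circ> id) (?f \<circ> Inr \<circ> id) g' v = 0}"
  proof (rule num_B_flows_product[OF B _ orient])
    show "multigraph X" using X by (simp add: labelled_graph_def)
    show "multigraph K1" by (simp add: multigraph_def K1_def)
    show "orientation K1 (id, id)" by (simp add: orientation_def K1_def)
    show "(a, Inl (?f a)) \<in> glue X K1" if "a \<in> verts X <+> verts K1" for a
      using that refl glue1 glue12 by (auto simp: c_def K1_def)
  qed (use X in \<open>auto simp: c_def\<close>)
  also have "{(g, g') \<in> (edges X \<rightarrow>\<^sub>E B) \<times> (edges K1 \<rightarrow>\<^sub>E B). \<forall>v\<in>?f ` (verts X <+> verts K1).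
      excess (edges X) (?f \<circ> Inl \<circ> t) (?f \<circ> Inl \<circ> h) g v +
      excess (edges K1) (?f \<circ> Inr \<circ> id) (?f \<circ> Inr \<circ> id) g' v = 0}
    = {g \<in> edges X \<rightarrow>\<^sub>E B. \<forall>v\<in>verts X - {lab2 X}. excess (edges X) (c \<circ> t) (c \<circ> h) g v = 0}
      \<times> {\<lambda>_. undefined}" (is "?L = ?M \<times> _")
    unfolding V by (auto simp: K1_def excess_def comp_def)
  also have "?M = flows_between B X t h"
  proof (rule set_eqI, rule iffI)
    fix g assume g: "g \<in> ?M"
    have "excess (edges X) t h g v = 0" if "v \<in> verts X - {lab1 X, lab2 X}" for v
      using g that ex[of v g] by auto
    then show "g \<in> flows_between B X t h"
      using g unfolding flows_between_def by blast
  next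
    fix g assume g: "g \<in> flows_between B X t h"
    then show "g \<in> ?M"
      using flows_between_excess_lab2[OF g] by (auto simp: flows_between_def ex)
  qed
  finally show ?thesis by (simp add: card_cartesian_product)
qed

text \<open>The new edges are directed from label 1 to label 2, so their values must add up to the
  excess at label 1. Conservation at label 2 is then automatic.\<close>

lemma num_B_flows_product_P1_power:
  "num_B_flows B (unlabel (product X (P1_power k))) =
    (\<Sum>g\<in>flows_between B X t h. num_sums B k (excess (edges X) t h g (lab1 X)))"
proof -
  let ?Y = "P1_power k" and ?ex = "excess (edges X) t h"
  let ?f = "case_sum (\<lambda>x. x) (\<lambda>y::nat. if y = 1 then lab1 X else lab2 X)"
  let ?t = "\<lambda>_::nat. 1::nat" and ?h = "\<lambda>_::nat. 2::nat"
  have glue: "(Inr 1, Inl (lab1 X)) \<in> glue X ?Y" "(Inr 2, Inl (lab2 X)) \<in> glue X ?Y"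
    by (auto simp: glue_def P1_power_def Let_def)
  have refl: "(a, a) \<in> glue X ?Y" for a by (simp add: glue_def)
  have V: "?f ` (verts X <+> verts ?Y) = verts X"
    using lab_in_verts by (auto simp: Plus_def image_Un image_image P1_power_def)
  have ex: "excess (edges ?Y) (?f \<circ> Inr \<circ> ?t) (?f \<circ> Inr \<circ> ?h) g v =
      (if v = lab2 X then (\<Sum>i<k. g i) else 0) - (if v = lab1 X then (\<Sum>i<k. g i) else 0)"
    for g :: "nat \<Rightarrow> 'g" and v
    using X(2) by (auto simp: excess_def P1_power_def sum_negf)
  have "num_B_flows B (unlabel (product X ?Y)) =
    card {(g, g') \<in> (edges X \<rightarrow>\<^sub>E B) \<times> (edges ?Y \<rightarrow>\<^sub>E B). \<forall>v\<in>?f ` (verts X <+> verts ?Y).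
      excess (edges X) (?f \<circ> Inl \<circ> t) (?f \<circ> Inl \<circ> h) g v +
      excess (edges ?Y) (?f \<circ> Inr \<circ> ?t) (?f \<circ> Inr \<circ> ?h) g' v = 0}"
  proof (rule num_B_flows_product[OF B _ orient])
    show "multigraph X" using X by (simp add: labelled_graph_def)
    show "multigraph ?Y" by (simp add: multigraph_def P1_power_def)
    show "orientation ?Y (?t, ?h)" by (simp add: orientation_def P1_power_def)
    show "(a, Inl (?f a)) \<in> glue X ?Y" if "a \<in> verts X <+> verts ?Y" for a
      using that refl glue by (auto simp: P1_power_def)
  qed (auto simp: P1_power_def)
  also have "{(g, g') \<in> (edges X \<rightarrow>\<^sub>E B) \<times> (edges ?Y \<rightarrow>\<^sub>E B). \<forall>v\<in>?f ` (verts X <+> verts ?Y).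
      excess (edges X) (?f \<circ> Inl \<circ> t) (?f \<circ> Inl \<circ> h) g v +
      excess (edges ?Y) (?f \<circ> Inr \<circ> ?t) (?f \<circ> Inr \<circ> ?h) g' v = 0}
    = (SIGMA g:flows_between B X t h. {g' \<in> {..<k} \<rightarrow>\<^sub>E B. (\<Sum>i<k. g' i) = ?ex g (lab1 X)})"
    (is "?L = ?M")
  proof (rule set_eqI, rule iffI)
    fix r assume "r \<in> ?L"
    then obtain g g' where r: "r = (g, g')" "g \<in> edges X \<rightarrow>\<^sub>E B" "g' \<in> {..<k} \<rightarrow>\<^sub>E B"
      "\<And>v. v \<in> verts X \<Longrightarrow> ?ex g v + ((if v = lab2 X then (\<Sum>i<k. g' i) else 0)
         - (if v = lab1 X then (\<Sum>i<k. g' i) else 0)) = 0"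
      unfolding V ex by (auto simp: comp_def P1_power_def)
    have "?ex g v = 0" if "v \<in> verts X - {lab1 X, lab2 X}" for v
      using r(4)[of v] that by simp
    then have "g \<in> flows_between B X t h"
      using r(2) unfolding flows_between_def by blast
    then show "r \<in> ?M"
      using r(1-3) r(4)[OF lab_in_verts(1)] X(2) by (auto)
  next
    fix r assume "r \<in> ?M"
    then obtain g g' where r: "r = (g, g')" and g: "g \<in> flows_between B X t h"
      and g': "g' \<in> {..<k} \<rightarrow>\<^sub>E B" "(\<Sum>i<k. g' i) = ?ex g (lab1 X)"
      by auto
    then show "r \<in> ?L"
      using X(2) flows_between_excess_lab2[OF g] unfolding V ex
      by (auto simp: comp_def P1_power_def flows_between_def)
  qed
  also have "card \<dots> = (\<Sum>g\<in>flows_between B X t h. num_sums B k (?ex g (lab1 X)))"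
    unfolding num_sums_def
    by (rule card_SigmaI) (auto intro!: finite_flows_between finite_subset[of _ "{..<k} \<rightarrow>\<^sub>E B"] finite_PiE)
  finally show ?thesis .
qed

text \<open>All values of the flow lie in the subgroup generated by \<open>B\<close>. Hence only the entries of
  \<open>q(A)\<close> inside the component of \<open>0\<close> are met.\<close>

lemma excess_in_zero_component:
  assumes "g \<in> flows_between B X t h"
  shows "excess (edges X) t h g v \<in> zero_component B"
proof -
  have "x - y \<in> zero_component B" if "x \<in> zero_component B" "y \<in> zero_component B" for x y
    using zero_component_add[OF B that(1) zero_component_uminus[OF B that(2)]] by simp
  moreover have "g e \<in> zero_component B" if "e \<in> edges X" for e
    using assms that subset_zero_component[OF B] by (auto simp: flows_between_def PiE_def Pi_def)
  ultimately show ?thesis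
    unfolding excess_def by (auto intro!: zero_component_sum[OF B] simp: zero_component_0[OF B])
qed

end

section \<open>The contractor\<close>

lemma lookup_quantum_scale:
  "Poly_Mapping.lookup (quantum_scale c Z) Y = c * Poly_Mapping.lookup Z Y"
  by (simp add: quantum_scale_def Poly_Mapping.map.rep_eq when_def)

lemma lookup_sum_quantum:
  "Poly_Mapping.lookup (\<Sum>k\<in>K. Z k :: quantum) Y = (\<Sum>k\<in>K. Poly_Mapping.lookup (Z k) Y)"
  by (induction K rule: infinite_finite_induct) (auto simp: lookup_add)

text \<open>Summing over a common superset of the supports makes linearity visible.\<close>

lemma quantum_eval_altdef:
  assumes "finite K" "Poly_Mapping.keys Z \<subseteq> K"
  shows "quantum_eval h Z = (\<Sum>Y\<in>K. Poly_Mapping.lookup Z Y * h (unlabel Y))"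
  unfolding quantum_eval_def
  by (rule sum.mono_neutral_left) (use assms in \<open>auto simp: in_keys_iff\<close>)

lemma quantum_eval_sum:
  "quantum_eval h (\<Sum>k\<in>K. Z k) = (\<Sum>k\<in>K. quantum_eval h (Z k))"
proof -
  have add: "quantum_eval h (Z1 + Z2) = quantum_eval h Z1 + quantum_eval h Z2" for Z1 Z2
  proof -
    let ?K = "Poly_Mapping.keys Z1 \<union> Poly_Mapping.keys Z2"
    have "Poly_Mapping.keys (Z1 + Z2) \<subseteq> ?K"
      by (rule Poly_Mapping.keys_add)
    then show ?thesis
      by (simp add: quantum_eval_altdef[of ?K] lookup_add ring_distribs sum.distrib)
  qed
  show ?thesis
    by (induction K rule: infinite_finite_induct) (auto simp: add quantum_eval_def[of h 0])
qed

lemma quantum_eval_single: "quantum_eval h (Poly_Mapping.single Y c) = c * h (unlabel Y)"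
  by (simp add: quantum_eval_def)

text \<open>Coefficients \<open>c k\<close> may be zero, so the support of \<open>Z\<close> can be a proper subset of the graphs
  \<open>Y k\<close>; the linear combination is therefore described by its coefficient function.\<close>

lemma quantum_eval_product_combination:
  fixes Y :: "nat \<Rightarrow> graph2"
  assumes Y: "inj_on Y K" and fin: "finite K"
    and Z: "\<And>y. Poly_Mapping.lookup Z y = (\<Sum>k\<in>K. c k * (1 when Y k = y))"
  shows "quantum_eval h (quantum_product (Poly_Mapping.single X 1) Z) =
    (\<Sum>k\<in>K. c k * h (unlabel (product X (Y k))))"
proof -
  have Zk: "Poly_Mapping.lookup Z (Y k) = c k" if "k \<in> K" for k
  proof -
    have "Poly_Mapping.lookup Z (Y k) = (\<Sum>j\<in>K. if j = k then c k else 0)"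
      unfolding Z by (rule sum.cong) (use Y that in \<open>auto simp: when_def inj_on_eq_iff\<close>)
    then show ?thesis using that fin by simp
  qed
  have keys: "Poly_Mapping.keys Z \<subseteq> Y ` K"
  proof
    fix y assume "y \<in> Poly_Mapping.keys Z"
    then have "(\<Sum>k\<in>K. c k * (1 when Y k = y)) \<noteq> 0"
      by (simp add: in_keys_iff Z)
    then show "y \<in> Y ` K"
      by (metis (mono_tags, lifting) image_eqI mult_zero_right sum.neutral when_neq_zero)
  qed
  have "quantum_eval h (quantum_product (Poly_Mapping.single X 1) Z) =
    (\<Sum>y\<in>Poly_Mapping.keys Z. Poly_Mapping.lookup Z y * h (unlabel (product X y)))"
    by (simp add: quantum_product_def quantum_eval_sum quantum_eval_single)
  also have "\<dots> = (\<Sum>y\<in>Y ` K. Poly_Mapping.lookup Z y * h (unlabel (product X y)))"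
    by (rule sum.mono_neutral_left) (use keys fin in \<open>auto simp: in_keys_iff\<close>)
  also have "\<dots> = (\<Sum>k\<in>K. c k * h (unlabel (product X (Y k))))"
    by (simp add: sum.reindex[OF Y] Zk)
  finally show ?thesis .
qed

theorem theorem15:
  fixes B :: "'g::{ab_group_add, finite} set"
    and A :: "((real, 'g) vec, 'g) vec" and p q :: "real poly" and n a l :: nat and Z :: quantum
  assumes "n = CARD('g)"
    and "B \<subseteq> UNIV - {0}" and "uminus ` B = B"
    and "A = adjacency_matrix (Cayley B)"
    and "p = min_poly A" and "l = Polynomial.degree p"
    and "q = p div [:- real (card B), 1:]"
    and "a = card (connected_components (Cayley B))"
    and "Z = quantum_scale (real n / (real a * poly q (real (card B))))
               (\<Sum>k\<in>{0..l - 1}. quantum_scale (coeff q k) (Poly_Mapping.single (P1_power k) 1))"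
  shows "contractor (\<lambda>G. real (num_B_flows B G)) Z"
proof -
  note B = assms(3)
  let ?d = "real (card B)" and ?h = "\<lambda>G::graph. real (num_B_flows B G)"
  define s where "s = real n / (real a * poly q ?d)"
  have q: "q = min_poly (adjacency_matrix (Cayley B)) div [:- real (card B), 1:]"
    using assms by simp
  have deg: "Polynomial.degree q = l - 1"
    using walk_poly_min_poly_quotient(1)[OF B] assms by simp
  have qd: "poly q ?d \<noteq> 0"
    using walk_poly_min_poly_quotient(2)[OF B] unfolding q .
  have na: "card (zero_component B) * a = n"
    using card_components_Cayley[OF B] assms by simp
  have "n \<noteq> 0" using assms(1) by simp
  have walk: "s * walk_poly B q x = 1" if "x \<in> zero_component B" for x
  proof -
    have "walk_poly B q x = poly q ?d / real (card (zero_component B))"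
      using walk_poly_min_poly_quotient(3)[OF B that] unfolding q .
    moreover have "card (zero_component B) \<noteq> 0" "a \<noteq> 0"
      using na \<open>n \<noteq> 0\<close> by auto
    ultimately show ?thesis
      using qd by (simp add: s_def field_simps flip: na)
  qed
  have lookup: "Poly_Mapping.lookup Z y = (\<Sum>k\<in>{0..l - 1}. s * coeff q k * (1 when P1_power k = y))" for y
    unfolding assms(9) s_def
    by (simp add: lookup_quantum_scale lookup_sum_quantum lookup_single sum_distrib_left mult_ac)
  have inj: "inj_on P1_power {0..l - 1}"
    by (auto simp: inj_on_def P1_power_def)
  have "quantum_graph Z"
    unfolding quantum_graph_def
  proof
    fix y assume "y \<in> Poly_Mapping.keys Z"
    then have "(\<Sum>k\<in>{0..l - 1}. s * coeff q k * (1 when P1_power k = y)) \<noteq> 0"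
      by (simp add: in_keys_iff lookup)
    then obtain k where "y = P1_power k"
      by (metis (mono_tags, lifting) mult_zero_right sum.neutral when_neq_zero)
    then show "labelled_graph y"
      by (simp add: labelled_graph_def multigraph_def loopless_def P1_power_def)
  qed
  moreover have "quantum_eval ?h (quantum_product (Poly_Mapping.single X 1) Z)
      = ?h (unlabel (product X K1))"
    if X: "labelled_graph X" "lab1 X \<noteq> lab2 X" for X
  proof -
    obtain t h where o: "orientation X (t, h)"
      using orientation_exists X by (metis labelled_graph_def surj_pair)
    let ?S = "flows_between B X t h" and ?ex = "\<lambda>g. excess (edges X) t h g (lab1 X)"
    have "quantum_eval ?h (quantum_product (Poly_Mapping.single X 1) Z)
      = (\<Sum>k\<in>{0..l - 1}. s * coeff q k * ?h (unlabel (product X (P1_power k))))"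
      by (rule quantum_eval_product_combination[OF inj _ lookup]) simp
    also have "\<dots> = (\<Sum>k\<le>l - 1. \<Sum>g\<in>?S. s * (coeff q k * real (num_sums B k (?ex g))))"
      by (simp add: num_B_flows_product_P1_power[OF B X o] sum_distrib_left mult_ac atMost_atLeast0)
    also have "\<dots> = (\<Sum>g\<in>?S. s * walk_poly B q (?ex g))"
      by (subst sum.swap) (simp add: walk_poly_def deg sum_distrib_left)
    also have "\<dots> = (\<Sum>g\<in>?S. 1)"
      by (rule sum.cong[OF refl]) (simp add: walk excess_in_zero_component[OF B X o])
    also have "\<dots> = ?h (unlabel (product X K1))"
      by (simp add: num_B_flows_product_K1[OF B X o])
    finally show ?thesis .
  qed
  ultimately show ?thesis
    by (simp add: contractor_def graph_parameter_num_B_flows[OF B])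
qed

end
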